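(* Let $\theta=\frac{1+\sqrt5}{2}$ and $R=\mathbb Z[\theta]$. For the non-crystallographic root system $H_2:=I_2(5)$, with Weyl group $W$ (the dihedral group of order $10$) acting on the free $R$-module $\Lambda=R\omega_1\oplus R\omega_2$ spanned by the fundamental weights, the second exponent $\tau_2$ (an element of $R$ defined up to units of $R$) is $\sqrt5$.
   Context: The ring $R=\mathbb Z[\theta]$ is a Euclidean domain containing $\sqrt5=2\theta-1$. Let $\alpha_1,\alpha_2$ be the simple roots of $H_2$, related to the dual basis $\omega_1,\omega_2$ (the fundamental weights) by $\alpha_1=2\omega_1-\theta\omega_2$ and $\alpha_2=-\theta\omega_1+2\omega_2$. The group $W$ is generated by the $R$-linear reflections $s_1,s_2$ with $s_i(\omega_j)=\omega_j-\delta_{ij}\alpha_i$. Exponents over $R$ are defined in the same way as over $\mathbb Z$, as follows in degree $2$. Let $S^*(\Lambda)$ be the symmetric algebra of the $R$-module $\Lambda$, let $I_a^W$ be the ideal of $S^*(\Lambda)$ generated by the $W$-invariant elements of positive degree (more precisely, those with zero constant term), and let $(I_a^W)^{(2)}=I_a^W\cap S^2(\Lambda)$. For $\chi\in\Lambda$ with $W$-orbit $W(\chi)$, put $\phi^{(1)}(\rho(\chi))=\sum_{\lambda\in W(\chi)}\lambda$ and $\phi^{(2)}(\rho(\chi))=\tfrac12\sum_{\lambda\in W(\chi)}(\lambda^2+\lambda(2))$, where $\lambda(2)=a_1\omega_1^2+a_2\omega_2^2$ for $\lambda=a_1\omega_1+a_2\omega_2$. Let $P\subseteq S^2(\Lambda)$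 be the $R$-submodule generated by all $\phi^{(2)}(\rho(\chi))$ and all $f\cdot\phi^{(1)}(\rho(\chi))$, with $\chi\in\Lambda$ and $f\in\Lambda$. The second exponent $\tau_2$ is the greatest common divisor in $R$ of all non-zero $N\in R$ such that $N\cdot(I_a^W)^{(2)}\subseteq P$. *)

theory Defs
  imports
    Complex_Main
    "HOL-Library.Product_Plus"
    "HOL-Computational_Algebra.Polynomial"
    "HOL-Algebra.Bij"
    "HOL-Algebra.Generated_Groups"
begin

section \<open>The ring \<open>R = \<int>[\<theta>]\<close>\<close>

definition golden :: real where
  "golden = (1 + sqrt 5) / 2"

lemma golden_sq: "golden * golden = golden + 1"
  by (simp add: golden_def field_simps)

lemma range_int_poly_golden:
  "range (\<lambda>p :: int poly. poly (map_poly real_of_int p) golden)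
    = {of_int a + of_int b * golden | a b :: int. True}"
proof (intro equalityI subsetI)
  fix x assume "x \<in> range (\<lambda>p :: int poly. poly (map_poly real_of_int p) golden)"
  then obtain p :: "int poly" where x: "x = poly (map_poly real_of_int p) golden" by blast
  have "\<exists>a b :: int. poly (map_poly real_of_int p) golden = of_int a + of_int b * golden"
  proof (induction p)
    case 0
    show ?case by (rule exI[of _ 0], rule exI[of _ 0]) simp
  next
    case (pCons c p)
    then obtain a b :: int where
      ab: "poly (map_poly real_of_int p) golden = of_int a + of_int b * golden" by blast
    have "poly (map_poly real_of_int (pCons c p)) golden
        = of_int c + of_int a * golden + of_int b * (golden * golden)"
      by (simp add: map_poly_pCons ab algebra_simps)
    also have "\<dots> = of_int (c + b) + of_int (a + b) * golden"
      by (simp only: golden_sq) (simp add: algebra_simps)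
    finally show ?case by blast
  qed
  then show "x \<in> {of_int a + of_int b * golden | a b :: int. True}" using x by blast
next
  fix x assume "x \<in> {of_int a + of_int b * golden | a b :: int. True}"
  then obtain a b :: int where "x = of_int a + of_int b * golden" by blast
  then have "x = poly (map_poly real_of_int [:a, b:]) golden"
    by (simp add: map_poly_pCons)
  then show "x \<in> range (\<lambda>p :: int poly. poly (map_poly real_of_int p) golden)" by blast
qed

text \<open>\<open>\<int>[\<theta>]\<close> as the image of \<open>\<int>[x]\<close> under evaluation at \<open>\<theta>\<close>;
  \<open>real_of_zgolden\<close> is the inclusion into \<open>\<real>\<close>.\<close>

typedef zgolden = "range (\<lambda>p :: int poly. poly (map_poly real_of_int p) golden)"
  morphisms real_of_zgolden Abs_zgolden
  by blast

setup_lifting type_definition_zgolden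

instantiation zgolden :: idom
begin

lift_definition zero_zgolden :: zgolden is 0
  by (rule range_eqI[of _ _ 0]) simp

lift_definition one_zgolden :: zgolden is 1
  by (rule range_eqI[of _ _ 1]) simp

lift_definition plus_zgolden :: "zgolden \<Rightarrow> zgolden \<Rightarrow> zgolden" is "(+)"
  unfolding range_int_poly_golden
proof clarify
  fix a b c d :: int
  show "\<exists>e f :: int. (of_int a + of_int b * golden) + (of_int c + of_int d * golden)
      = of_int e + of_int f * golden \<and> True"
    by (rule exI[of _ "a + c"], rule exI[of _ "b + d"]) (simp add: algebra_simps)
qed

lift_definition uminus_zgolden :: "zgolden \<Rightarrow> zgolden" is uminus
  unfolding range_int_poly_golden
proof clarify
  fix a b :: int
  show "\<exists>e f :: int. - (of_int a + of_int b * golden) = of_int e + of_int f * golden \<and> True"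
    by (rule exI[of _ "- a"], rule exI[of _ "- b"]) (simp add: algebra_simps)
qed

lift_definition minus_zgolden :: "zgolden \<Rightarrow> zgolden \<Rightarrow> zgolden" is "(-)"
  unfolding range_int_poly_golden
proof clarify
  fix a b c d :: int
  show "\<exists>e f :: int. (of_int a + of_int b * golden) - (of_int c + of_int d * golden)
      = of_int e + of_int f * golden \<and> True"
    by (rule exI[of _ "a - c"], rule exI[of _ "b - d"]) (simp add: algebra_simps)
qed

lift_definition times_zgolden :: "zgolden \<Rightarrow> zgolden \<Rightarrow> zgolden" is "(*)"
  unfolding range_int_poly_golden
proof clarify
  fix a b c d :: int
  have "(of_int a + of_int b * golden) * (of_int c + of_int d * golden)
     = of_int (a * c) + of_int (a * d + b * c) * golden + of_int (b * d) * (golden * golden)"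
    by (simp add: algebra_simps)
  also have "\<dots> = of_int (a * c + b * d) + of_int (a * d + b * c + b * d) * golden"
    by (simp only: golden_sq) (simp add: algebra_simps)
  finally show "\<exists>e f :: int. (of_int a + of_int b * golden) * (of_int c + of_int d * golden)
      = of_int e + of_int f * golden \<and> True" by blast
qed

instance
  by standard (transfer; simp add: algebra_simps)+

end

lemma real_of_zgolden_hom [simp]:
  "real_of_zgolden 0 = 0"
  "real_of_zgolden 1 = 1"
  "real_of_zgolden (x + y) = real_of_zgolden x + real_of_zgolden y"
  "real_of_zgolden (x - y) = real_of_zgolden x - real_of_zgolden y"
  "real_of_zgolden (- x) = - real_of_zgolden x"
  "real_of_zgolden (x * y) = real_of_zgolden x * real_of_zgolden y"
  by (transfer, simp)+

lemma real_of_zgolden_of_nat [simp]: "real_of_zgolden (of_nat n) = of_nat n"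
  by (induction n) simp_all

lemma real_of_zgolden_numeral [simp]: "real_of_zgolden (numeral k) = numeral k"
  using real_of_zgolden_of_nat[of "numeral k"] by simp

instance zgolden :: ring_char_0
proof
  show "inj (of_nat :: nat \<Rightarrow> zgolden)"
  proof (rule injI)
    fix m n :: nat
    assume "(of_nat m :: zgolden) = of_nat n"
    then have "real_of_zgolden (of_nat m) = real_of_zgolden (of_nat n)" by simp
    then show "m = n" by simp
  qed
qed

lift_definition theta :: zgolden is golden
  by (rule range_eqI[of _ _ "[:0, 1:]"]) (simp add: map_poly_pCons)

lemma theta_sq: "theta * theta = theta + 1"
  by transfer (rule golden_sq)

lemma real_of_zgolden_sqrt5: "real_of_zgolden (2 * theta - 1) = sqrt 5"
  by (simp add: theta.rep_eq golden_def field_simps)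

section \<open>The lattice \<open>\<Lambda> = R \<omega>\<^sub>1 \<oplus> R \<omega>\<^sub>2\<close> and the group \<open>W\<close>\<close>

text \<open>An element \<open>(a\<^sub>1, a\<^sub>2)\<close> of \<open>\<Lambda>\<close> stands for \<open>a\<^sub>1 \<omega>\<^sub>1 + a\<^sub>2 \<omega>\<^sub>2\<close>.\<close>

type_synonym lattice = "zgolden \<times> zgolden"

definition lscale :: "zgolden \<Rightarrow> lattice \<Rightarrow> lattice" where
  "lscale r v = (r * fst v, r * snd v)"

definition omega1 :: lattice where "omega1 = (1, 0)"
definition omega2 :: lattice where "omega2 = (0, 1)"

definition alpha1 :: lattice where "alpha1 = lscale 2 omega1 - lscale theta omega2"
definition alpha2 :: lattice where "alpha2 = lscale 2 omega2 - lscale theta omega1"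

text \<open>The \<open>R\<close>-linear maps with \<open>s\<^sub>i(\<omega>\<^sub>j) = \<omega>\<^sub>j - \<delta>\<^sub>i\<^sub>j \<alpha>\<^sub>i\<close>.\<close>

definition s1 :: "lattice \<Rightarrow> lattice" where
  "s1 v = lscale (fst v) (omega1 - alpha1) + lscale (snd v) omega2"

definition s2 :: "lattice \<Rightarrow> lattice" where
  "s2 v = lscale (fst v) omega1 + lscale (snd v) (omega2 - alpha2)"

definition W :: "(lattice \<Rightarrow> lattice) set" where
  "W = generate (BijGroup UNIV) {s1, s2}"

definition orbit :: "lattice \<Rightarrow> lattice set" where
  "orbit \<chi> = (\<lambda>w. w \<chi>) ` W"

section \<open>The symmetric algebra \<open>S\<^sup>*(\<Lambda>)\<close>\<close>

text \<open>Since \<open>\<Lambda>\<close> is free on \<open>\<omega>\<^sub>1, \<omega>\<^sub>2\<close>, its symmetric algebra is the polynomial ring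
  \<open>R[\<omega>\<^sub>1][\<omega>\<^sub>2]\<close>: the coefficient of \<open>\<omega>\<^sub>1\<^sup>i \<omega>\<^sub>2\<^sup>j\<close> in \<open>p\<close> is
  \<open>coeff (coeff p j) i\<close>.\<close>

type_synonym symalg = "zgolden poly poly"

definition const :: "zgolden \<Rightarrow> symalg" where
  "const c = [:[:c:]:]"

definition X1 :: symalg where "X1 = [:[:0, 1:]:]"
definition X2 :: symalg where "X2 = [:0, 1:]"

definition sym_incl :: "lattice \<Rightarrow> symalg" where
  "sym_incl v = const (fst v) * X1 + const (snd v) * X2"

definition sym_deg2 :: "symalg set" where
  "sym_deg2 = {p. \<forall>i j. coeff (coeff p j) i \<noteq> 0 \<longrightarrow> i + j = 2}"

text \<open>The \<open>R\<close>-algebra endomorphism of \<open>S\<^sup>*(\<Lambda>)\<close> induced by an \<open>R\<close>-linear map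
  \<open>w\<close> of \<open>\<Lambda>\<close>: substitute \<open>w(\<omega>\<^sub>1)\<close> and \<open>w(\<omega>\<^sub>2)\<close> for the variables.\<close>

definition sym_map :: "(lattice \<Rightarrow> lattice) \<Rightarrow> symalg \<Rightarrow> symalg" where
  "sym_map w p = poly (map_poly (\<lambda>q. poly (map_poly const q) (sym_incl (w omega1))) p)
                      (sym_incl (w omega2))"

definition const_term :: "symalg \<Rightarrow> zgolden" where
  "const_term p = coeff (coeff p 0) 0"

text \<open>Ideals of \<open>S\<^sup>*(\<Lambda>)\<close> are submodules of \<open>S\<^sup>*(\<Lambda>)\<close> over itself, so the ideal generated
  by a set is its \<open>S\<^sup>*(\<Lambda>)\<close>-span.\<close>

interpretation sym_self: module "(*) :: symalg \<Rightarrow> symalg \<Rightarrow> symalg"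
  by standard (simp_all add: algebra_simps)

interpretation sym_R: module "\<lambda>r (p :: symalg). const r * p"
  by standard (simp_all add: const_def smult_add_right pCons_one smult_add_left[symmetric])

definition invariant_ideal :: "symalg set" where
  "invariant_ideal = sym_self.span {p. (\<forall>w\<in>W. sym_map w p = p) \<and> const_term p = 0}"

definition invariant_ideal2 :: "symalg set" where
  "invariant_ideal2 = invariant_ideal \<inter> sym_deg2"

section \<open>The maps \<open>\<phi>\<^sup>(\<^sup>1\<^sup>)\<close> and \<open>\<phi>\<^sup>(\<^sup>2\<^sup>)\<close> and the second exponent\<close>

text \<open>\<open>phi1 \<chi>\<close> and \<open>phi2 \<chi>\<close> are \<open>\<phi>\<^sup>(\<^sup>1\<^sup>)(\<rho>(\<chi>))\<close> and \<open>\<phi>\<^sup>(\<^sup>2\<^sup>)(\<rho>(\<chi>))\<close>.\<close>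

definition phi1 :: "lattice \<Rightarrow> symalg" where
  "phi1 \<chi> = (\<Sum>v\<in>orbit \<chi>. sym_incl v)"

definition lambda2 :: "lattice \<Rightarrow> symalg" where
  "lambda2 v = const (fst v) * X1 ^ 2 + const (snd v) * X2 ^ 2"

definition phi2_double :: "lattice \<Rightarrow> symalg" where
  "phi2_double \<chi> = (\<Sum>v\<in>orbit \<chi>. sym_incl v ^ 2 + lambda2 v)"

text \<open>The element \<open>2\<close> is not invertible in \<open>S\<^sup>*(\<Lambda>)\<close>, and a single summand
  \<open>\<lambda>\<^sup>2 + \<lambda>(2)\<close> need not be divisible by \<open>2\<close> (for \<open>\<lambda> = \<theta> \<omega>\<^sub>1\<close> it is
  \<open>(2 \<theta> + 1) \<omega>\<^sub>1\<^sup>2\<close>); the sum over an orbit always is, uniquely, see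
  \<open>phi2_ex1\<close> below.\<close>

definition phi2 :: "lattice \<Rightarrow> symalg" where
  "phi2 \<chi> = (THE q. 2 * q = phi2_double \<chi>)"

definition P2 :: "symalg set" where
  "P2 = sym_R.span (range phi2 \<union> {sym_incl f * phi1 \<chi> | f \<chi>. True})"

text \<open>Greatest common divisors are determined only up to units, so this is a predicate.\<close>

definition is_gcd_of :: "'a :: comm_ring_1 \<Rightarrow> 'a set \<Rightarrow> bool" where
  "is_gcd_of d A \<longleftrightarrow> (\<forall>a\<in>A. d dvd a) \<and> (\<forall>c. (\<forall>a\<in>A. c dvd a) \<longrightarrow> c dvd d)"

definition is_second_exponent :: "zgolden \<Rightarrow> bool" where
  "is_second_exponent t \<longleftrightarrow>
     is_gcd_of t {N. N \<noteq> 0 \<and> (\<forall>p\<in>invariant_ideal2. const N * p \<in> P2)}"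

section \<open>Well-definedness\<close>

lemma s1_eq: "s1 (a, b) = (- a, b + theta * a)"
  by (simp add: s1_def alpha1_def omega1_def omega2_def lscale_def algebra_simps)

lemma s2_eq: "s2 (a, b) = (a + theta * b, - b)"
  by (simp add: s2_def alpha2_def omega1_def omega2_def lscale_def algebra_simps)

lemma s1_fundamental: "s1 omega1 = omega1 - alpha1" "s1 omega2 = omega2"
  by (simp_all add: s1_def omega1_def omega2_def alpha1_def lscale_def)

lemma s2_fundamental: "s2 omega1 = omega1" "s2 omega2 = omega2 - alpha2"
  by (simp_all add: s2_def omega1_def omega2_def alpha2_def lscale_def)

lemma s1_invol: "s1 (s1 v) = v"
  by (cases v) (simp add: s1_eq)

lemma s2_invol: "s2 (s2 v) = v"
  by (cases v) (simp add: s2_eq)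

lemma theta_sq': "theta * (theta * x) = theta * x + x"
proof -
  have "theta * (theta * x) = (theta * theta) * x" by (simp only: mult.assoc)
  then show ?thesis by (simp only: theta_sq) (simp add: algebra_simps)
qed

lemma braid: "s2 (s1 (s2 (s1 (s2 v)))) = s1 (s2 (s1 (s2 (s1 v))))"
  by (cases v) (simp add: s1_eq s2_eq algebra_simps theta_sq theta_sq')

lemma s_Bij: "s1 \<in> Bij UNIV" "s2 \<in> Bij UNIV"
  unfolding Bij_def by (auto intro!: o_bij[of s1 s1] o_bij[of s2 s2] simp: s1_invol s2_invol fun_eq_iff)

lemma s_inv: "inv\<^bsub>BijGroup UNIV\<^esub> s1 = s1" "inv\<^bsub>BijGroup UNIV\<^esub> s2 = s2"
proof -
  interpret group "BijGroup (UNIV :: lattice set)" by (rule group_BijGroup)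
  show "inv\<^bsub>BijGroup UNIV\<^esub> s1 = s1"
    by (rule inv_equality) (use s_Bij in \<open>auto simp: BijGroup_def compose_def s1_invol\<close>)
  show "inv\<^bsub>BijGroup UNIV\<^esub> s2 = s2"
    by (rule inv_equality) (use s_Bij in \<open>auto simp: BijGroup_def compose_def s2_invol\<close>)
qed

lemma W_subset_Bij: "w \<in> W \<Longrightarrow> w \<in> Bij UNIV"
  using group.generate_in_carrier[OF group_BijGroup, of "{s1, s2}" UNIV w] s_Bij
  by (auto simp: W_def BijGroup_def)

lemma BijGroup_mult: "g \<in> Bij UNIV \<Longrightarrow> f \<in> Bij UNIV \<Longrightarrow> g \<otimes>\<^bsub>BijGroup UNIV\<^esub> f = g \<circ> f"
  by (simp add: BijGroup_def compose_def fun_eq_iff)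

lemma restrict_UNIV: "restrict f UNIV = f"
  by (simp add: fun_eq_iff)

lemma W_id: "id \<in> W"
  using generate.one[of "BijGroup UNIV" "{s1, s2}"]
  by (simp add: W_def BijGroup_def id_def restrict_UNIV)

lemma W_s1: "s1 \<in> W" and W_s2: "s2 \<in> W"
  unfolding W_def by (auto intro: generate.incl)

lemma W_comp: "g \<in> W \<Longrightarrow> f \<in> W \<Longrightarrow> g \<circ> f \<in> W"
  using generate.eng[of g "BijGroup UNIV" "{s1, s2}" f] W_subset_Bij[of g] W_subset_Bij[of f]
  by (simp add: W_def[symmetric] BijGroup_mult)

definition dihedral_words :: "(lattice \<Rightarrow> lattice) set" where
  "dihedral_words =
    {id, s1, s2, s1 \<circ> s2, s2 \<circ> s1, s1 \<circ> (s2 \<circ> s1), s2 \<circ> (s1 \<circ> s2),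
     s1 \<circ> (s2 \<circ> (s1 \<circ> s2)), s2 \<circ> (s1 \<circ> (s2 \<circ> s1)), s1 \<circ> (s2 \<circ> (s1 \<circ> (s2 \<circ> s1)))}"

lemma s1_comp_s1: "s1 \<circ> (s1 \<circ> f) = f" "s1 \<circ> s1 = id"
  by (simp_all add: fun_eq_iff s1_invol)

lemma s2_comp_s2: "s2 \<circ> (s2 \<circ> f) = f" "s2 \<circ> s2 = id"
  by (simp_all add: fun_eq_iff s2_invol)

lemma braid_comp:
  "s2 \<circ> (s1 \<circ> (s2 \<circ> (s1 \<circ> s2))) = s1 \<circ> (s2 \<circ> (s1 \<circ> (s2 \<circ> s1)))"
  "s2 \<circ> (s1 \<circ> (s2 \<circ> (s1 \<circ> (s2 \<circ> s1)))) = s1 \<circ> (s2 \<circ> (s1 \<circ> s2))"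
  using braid[of "s1 _"] by (simp_all add: fun_eq_iff braid s1_invol)

lemma dihedral_words_closed:
  assumes "f \<in> dihedral_words"
  shows "s1 \<circ> f \<in> dihedral_words" "s2 \<circ> f \<in> dihedral_words"
  using assms unfolding dihedral_words_def
  by (auto simp: s1_comp_s1 s2_comp_s2 braid_comp simp del: comp_apply)

lemma W_eq: "W = dihedral_words"
proof
  have "\<forall>f \<in> dihedral_words. w \<circ> f \<in> dihedral_words" if "w \<in> W" for w
    using that unfolding W_def
  proof (induction rule: generate.induct)
    case one
    then show ?case by (simp add: BijGroup_def restrict_UNIV comp_def)
  next
    case (incl h)
    then show ?case using dihedral_words_closed by blast
  next
    case (inv h)
    then have "inv\<^bsub>BijGroup UNIV\<^esub> h = s1 \<or> inv\<^bsub>BijGroup UNIV\<^esub> h = s2" by (auto simp: s_inv)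
    then show ?case using dihedral_words_closed by metis
  next
    case (eng h1 h2)
    then have "h1 \<otimes>\<^bsub>BijGroup UNIV\<^esub> h2 = h1 \<circ> h2"
      by (intro BijGroup_mult W_subset_Bij) (simp_all add: W_def)
    with eng.IH show ?case by (auto simp: comp_assoc)
  qed
  moreover have "id \<in> dihedral_words" by (simp add: dihedral_words_def)
  ultimately show "W \<subseteq> dihedral_words" by force
  show "dihedral_words \<subseteq> W"
    unfolding dihedral_words_def by (auto intro!: W_comp W_id W_s1 W_s2)
qed

lemma finite_W: "finite W"
  by (simp add: W_eq dihedral_words_def)

lemma golden_bounds: "1 < golden" "golden < 2"
  by (simp_all add: golden_def real_less_lsqrt)

lemma card_W: "card W = 10"
proof -
  let ?e = "\<lambda>w :: lattice \<Rightarrow> lattice. map_prod real_of_zgolden real_of_zgolden (w (1, 1))"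
  have images: "?e ` W = {(1, 1), (- 1, 1 + golden), (1 + golden, - 1),
      (- golden - 1, 2 * golden), (2 * golden, - golden - 1),
      (- 2 * golden, 1 + golden), (1 + golden, - 2 * golden),
      (- golden - 1, 1), (1, - golden - 1), (- 1, - 1)}"
    unfolding W_eq dihedral_words_def
    by (simp add: s1_eq s2_eq theta.rep_eq algebra_simps golden_sq insert_commute uminus_add_conv_diff)
  have "card (?e ` W) = 10"
    unfolding images using golden_bounds by simp
  moreover have "card (?e ` W) \<le> card W"
    by (rule card_image_le[OF finite_W])
  moreover have "card W \<le> 10"
    unfolding W_eq dihedral_words_def
    by (rule card_insert_le_m1, simp)+ simp
  ultimately show ?thesis by simp
qed

lemma finite_orbit: "finite (orbit \<chi>)"
  by (simp add: orbit_def finite_W)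

lemma orbit_closed: "v \<in> orbit \<chi> \<Longrightarrow> s1 v \<in> orbit \<chi>" "v \<in> orbit \<chi> \<Longrightarrow> s2 v \<in> orbit \<chi>"
proof -
  have "g v \<in> orbit \<chi>" if "v \<in> orbit \<chi>" "g \<in> W" for g
  proof -
    from that obtain w where "w \<in> W" "v = w \<chi>" by (auto simp: orbit_def)
    with that(2) W_comp[of g w] show ?thesis
      unfolding orbit_def by (intro image_eqI[of _ _ "g \<circ> w"]) auto
  qed
  then show "v \<in> orbit \<chi> \<Longrightarrow> s1 v \<in> orbit \<chi>" "v \<in> orbit \<chi> \<Longrightarrow> s2 v \<in> orbit \<chi>"
    using W_s1 W_s2 by blast+
qed

lemma orbit_sum: "(\<Sum>v\<in>orbit \<chi>. fst v) = 0" "(\<Sum>v\<in>orbit \<chi>. snd v) = 0"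
proof -
  have bij1: "bij_betw s1 (orbit \<chi>) (orbit \<chi>)"
    by (rule bij_betw_byWitness[of _ s1]) (auto simp: s1_invol orbit_closed)
  have bij2: "bij_betw s2 (orbit \<chi>) (orbit \<chi>)"
    by (rule bij_betw_byWitness[of _ s2]) (auto simp: s2_invol orbit_closed)
  have "(\<Sum>v\<in>orbit \<chi>. fst v) = (\<Sum>v\<in>orbit \<chi>. fst (s1 v))"
    using sum.reindex_bij_betw[OF bij1, of fst] by simp
  also have "\<dots> = - (\<Sum>v\<in>orbit \<chi>. fst v)"
    by (simp add: s1_def alpha1_def omega1_def omega2_def lscale_def sum_negf)
  finally have "2 * (\<Sum>v\<in>orbit \<chi>. fst v) = 0" by (simp add: eq_neg_iff_add_eq_0)
  then show "(\<Sum>v\<in>orbit \<chi>. fst v) = 0" by simp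
  have "(\<Sum>v\<in>orbit \<chi>. snd v) = (\<Sum>v\<in>orbit \<chi>. snd (s2 v))"
    using sum.reindex_bij_betw[OF bij2, of snd] by simp
  also have "\<dots> = - (\<Sum>v\<in>orbit \<chi>. snd v)"
    by (simp add: s2_def alpha2_def omega1_def omega2_def lscale_def sum_negf)
  finally have "2 * (\<Sum>v\<in>orbit \<chi>. snd v) = 0" by (simp add: eq_neg_iff_add_eq_0)
  then show "(\<Sum>v\<in>orbit \<chi>. snd v) = 0" by simp
qed

lemma const_0: "const 0 = 0"
  by (simp add: const_def)

lemma const_sum: "(\<Sum>i\<in>A. const (f i)) = const (sum f A)"
  by (induction A rule: infinite_finite_induct) (auto simp: const_def)

lemma sum_sq_mod2:
  fixes f :: "'a \<Rightarrow> 'b :: comm_ring_1"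
  assumes "finite A"
  shows "2 dvd (\<Sum>i\<in>A. f i ^ 2) - (\<Sum>i\<in>A. f i) ^ 2"
  using assms
proof (induction A rule: finite_induct)
  case (insert x A)
  have "(\<Sum>i\<in>insert x A. f i ^ 2) - (\<Sum>i\<in>insert x A. f i) ^ 2
      = ((\<Sum>i\<in>A. f i ^ 2) - (\<Sum>i\<in>A. f i) ^ 2) - 2 * (f x * sum f A)"
    using insert.hyps by (simp add: power2_sum algebra_simps)
  then show ?case using insert.IH by simp
qed simp

lemma phi2_ex1: "\<exists>!q. 2 * q = phi2_double \<chi>"
proof (rule ex_ex1I)
  have sum0: "(\<Sum>v\<in>orbit \<chi>. sym_incl v) = 0"
    by (simp add: sym_incl_def sum.distrib sum_distrib_right[symmetric] const_sum const_0 orbit_sum)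
  have "(\<Sum>v\<in>orbit \<chi>. lambda2 v) = 0"
    by (simp add: lambda2_def sum.distrib sum_distrib_right[symmetric] const_sum const_0 orbit_sum)
  then have "phi2_double \<chi> = (\<Sum>v\<in>orbit \<chi>. sym_incl v ^ 2)"
    by (simp add: phi2_double_def sum.distrib)
  then have "2 dvd phi2_double \<chi>"
    using sum_sq_mod2[OF finite_orbit, of sym_incl \<chi>] sum0 by simp
  then show "\<exists>q. 2 * q = phi2_double \<chi>" by (metis dvd_def)
next
  fix q q' assume "2 * q = phi2_double \<chi>" "2 * q' = phi2_double \<chi>"
  then have "2 * q = 2 * q'" by simp
  then show "q = q'" by simp
qed

end

theory Submission
  imports Defs
begin

text \<open>Put \<open>s = 2\<theta> - 1\<close>, so that \<open>s = \<surd>5\<close> in \<open>\<real>\<close>, and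
  \<open>Q = \<omega>\<^sub>1\<^sup>2 - \<theta> \<omega>\<^sub>1\<omega>\<^sub>2 + \<omega>\<^sub>2\<^sup>2\<close>. Everything in degree two is a multiple of \<open>Q\<close>, and
  the exponent only records which multiples occur.

  On the side of the invariants, \<open>Q\<close> spans the invariant quadratic forms over \<open>R\<close>, and there
  are no non-zero invariant linear forms. Hence the part of degree two of the ideal is
  \<open>R Q\<close> (\<open>invariant_ideal2_eq\<close>).

  On the side of the orbits, coordinates sum to zero over an orbit, so \<open>\<phi>\<^sup>(\<^sup>1\<^sup>)\<close> vanishes
  and \<open>\<phi>\<^sup>(\<^sup>2\<^sup>)\<close> is half the sum of the squares. An orbit consists of one or two orbits
  of the rotation \<open>s\<^sub>1s\<^sub>2\<close> of order five, which fixes only the origin. On the rotation orbit of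
  \<open>a\<omega>\<^sub>1 + b\<omega>\<^sub>2 \<noteq> 0\<close> the squares sum to
  \<open>2 s \<theta> (a\<^sup>2 + \<theta>ab + b\<^sup>2) Q\<close>: the factor is
  \<open>2(\<theta> + 2)\<close> at \<open>\<omega>\<^sub>1\<close>, and \<open>\<theta> + 2 = s \<theta>\<close>. So every \<open>\<phi>\<^sup>(\<^sup>2\<^sup>)\<close> lies in \<open>R s Q\<close>, and
  the orbit of \<open>\<omega>\<^sub>1\<close> contributes \<open>s \<theta> Q\<close> itself. As \<open>\<theta>\<close> is a unit, \<open>P = R s Q\<close>
  (\<open>P2_eq\<close>).

  Therefore \<open>N\<close> multiplies \<open>R Q\<close> into \<open>P\<close> exactly when \<open>s\<close> divides \<open>N\<close>, and the greatest
  common divisor of the non-zero multiples of \<open>s\<close> is \<open>s\<close> up to units.\<close>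

section \<open>Quadratic forms in the symmetric algebra\<close>

definition quad :: "zgolden \<Rightarrow> zgolden \<Rightarrow> zgolden \<Rightarrow> symalg" where
  "quad a b c = [:[:0, 0, a:], [:0, b:], [:c:]:]"

definition invariant_form :: symalg where
  "invariant_form = quad 1 (- theta) 1"

lemma const_hom:
  "const (a + b) = const a + const b" "const (a * b) = const a * const b"
  "const 1 = 1"
  by (simp_all add: const_def pCons_one)

lemma const_mult_quad: "const r * quad a b c = quad (r * a) (r * b) (r * c)"
  by (simp add: const_def quad_def)

lemma quad_add: "quad a b c + quad a' b' c' = quad (a + a') (b + b') (c + c')"
  by (simp add: quad_def)

lemma double_quad: "2 * quad a b c = quad (2 * a) (2 * b) (2 * c)"
  by (simp only: mult_2 quad_add)

lemma quad_eq_iff: "quad a b c = quad a' b' c' \<longleftrightarrow> a = a' \<and> b = b' \<and> c = c'"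
  by (simp add: quad_def)

lemma sym_incl_poly: "sym_incl v = [:[:0, fst v:], [:snd v:]:]"
  by (simp add: sym_incl_def const_def X1_def X2_def)

lemma sym_incl_mult:
  "sym_incl v * sym_incl w
    = quad (fst v * fst w) (fst v * snd w + snd v * fst w) (snd v * snd w)"
  by (simp add: sym_incl_poly quad_def algebra_simps)

lemma multiple_of_invariant_form: "const r * invariant_form = quad r (- theta * r) r"
  by (simp add: invariant_form_def const_mult_quad algebra_simps)

lemma sym_deg2_eq_quad:
  assumes "p \<in> sym_deg2"
  shows "p = quad (coeff (coeff p 0) 2) (coeff (coeff p 1) 1) (coeff (coeff p 2) 0)"
proof (intro poly_eqI)
  fix i j :: nat
  have z: "coeff (coeff p j) i = 0" if "i + j \<noteq> 2" for i j :: nat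
    using assms that by (auto simp: sym_deg2_def)
  consider "i + j \<noteq> 2" | "i = 2" "j = 0" | "i = 1" "j = 1" | "i = 0" "j = 2" by force
  then show "coeff (coeff p j) i
    = coeff (coeff (quad (coeff (coeff p 0) 2) (coeff (coeff p 1) 1) (coeff (coeff p 2) 0)) j) i"
  proof cases
    case 1
    have "coeff (coeff (quad a b c) j) i = 0" for a b c
      using 1 by (auto simp: quad_def coeff_pCons split: nat.splits)
    with z[OF 1] show ?thesis by simp
  qed (simp_all add: quad_def coeff_pCons numeral_2_eq_2)
qed

section \<open>The invariant ideal in degree two\<close>

text \<open>The polynomials whose part of degree at most two is a constant multiple of
  \<open>invariant_form\<close>. Unlike the set of those multiples, this is an ideal, so that it bounds
  \<open>invariant_ideal\<close> from above as soon as it contains the generators; and it loses nothing in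
  degree two.\<close>

definition low_degree_multiples :: "symalg set" where
  "low_degree_multiples = {p. coeff (coeff p 0) 0 = 0 \<and>
     coeff (coeff p 0) 1 = 0 \<and> coeff (coeff p 1) 0 = 0 \<and>
     coeff (coeff p 1) 1 = - theta * coeff (coeff p 0) 2 \<and>
     coeff (coeff p 2) 0 = coeff (coeff p 0) 2}"

lemma low_degree_multiples_subspace: "sym_self.subspace low_degree_multiples"
  by (auto simp: sym_self.subspace_def low_degree_multiples_def coeff_mult coeff_sum
      numeral_2_eq_2 algebra_simps)

lemma coeff_sym_incl_mult:
  "coeff (coeff (sym_incl v * g) j) i
    = (if i = 0 then 0 else fst v * coeff (coeff g j) (i - 1))
      + (if j = 0 then 0 else snd v * coeff (coeff g (j - 1)) i)"
  by (cases i; cases j) (simp_all add: sym_incl_poly coeff_pCons)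

text \<open>A linear substitution preserves degrees, so each coefficient of the image is a combination
  of coefficients of the same total degree. One coefficient of degree two suffices: comparing the
  coefficients of \<open>\<omega>\<^sub>1\<omega>\<^sub>2\<close> for both reflections already determines the invariant quadratic
  forms.\<close>

lemma coeff_sym_map_low:
  fixes p :: symalg and w :: "lattice \<Rightarrow> lattice"
  defines "c \<equiv> \<lambda>i j. coeff (coeff p j) i"
    and "d \<equiv> \<lambda>i j. coeff (coeff (sym_map w p) j) i"
    and "x1 \<equiv> fst (w omega1)" and "y1 \<equiv> snd (w omega1)"
    and "x2 \<equiv> fst (w omega2)" and "y2 \<equiv> snd (w omega2)"
  shows "d 1 0 = c 1 0 * x1 + c 0 1 * x2"
    "d 0 1 = c 1 0 * y1 + c 0 1 * y2"
    "d 1 1 = 2 * c 2 0 * x1 * y1 + c 1 1 * (x1 * y2 + y1 * x2) + 2 * c 0 2 * x2 * y2"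
proof -
  obtain c00 c10 c20 p0 c01 c11 p1 c02 p2 q where
    p: "p = pCons (pCons c00 (pCons c10 (pCons c20 p0)))
    (pCons (pCons c01 (pCons c11 p1)) (pCons (pCons c02 p2) q))"
    by (metis pCons_cases)
  \<comment> \<open>The tails \<open>p0\<close>, \<open>p1\<close>, \<open>p2\<close>, \<open>q\<close> end up behind three linear factors, so they
    do not reach degree two; keeping \<open>e\<close> opaque lets the coefficients be read off.\<close>
  let ?x = "sym_incl (w omega1)" and ?y = "sym_incl (w omega2)"
  define e where "e = (\<lambda>q. poly (map_poly const q) ?x)"
  have expansion:
    "sym_map w p = const c00 + ?x * (const c10 + ?x * (const c20 + ?x * e p0))
      + ?y * (const c01 + ?x * (const c11 + ?x * e p1)
        + ?y * (const c02 + ?x * e p2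
          + ?y * poly (map_poly (\<lambda>q. poly (map_poly const q) ?x) q) ?y))"
    unfolding p sym_map_def e_def by (simp add: map_poly_pCons const_0)
  have const_coeff: "coeff (coeff (const a) j) i = (if i = 0 \<and> j = 0 then a else 0)" for a i j
    by (simp add: const_def coeff_pCons split: nat.splits)
  have c: "c 1 0 = c10" "c 0 1 = c01" "c 2 0 = c20" "c 1 1 = c11" "c 0 2 = c02"
    by (simp_all add: c_def p numeral_2_eq_2)
  show "d 1 0 = c 1 0 * x1 + c 0 1 * x2"
    "d 0 1 = c 1 0 * y1 + c 0 1 * y2"
    "d 1 1 = 2 * c 2 0 * x1 * y1 + c 1 1 * (x1 * y2 + y1 * x2) + 2 * c 0 2 * x2 * y2"
    unfolding c unfolding d_def expansion x1_def x2_def y1_def y2_def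
    by ((simp add: coeff_sym_incl_mult const_coeff; simp add: algebra_simps)+)
qed

lemma theta_inverse: "theta * (theta - 1) = 1"
  by (simp add: algebra_simps theta_sq)

text \<open>The reflection \<open>s\<^sub>i\<close> negates the coefficient of \<open>\<omega>\<^sub>i\<close>, which excludes linear terms. In
  degree two, \<open>s\<^sub>1\<close> forces the mixed coefficient to be \<open>-\<theta>\<close> times that of \<open>\<omega>\<^sub>1\<^sup>2\<close> and \<open>s\<^sub>2\<close>
  forces the same with \<open>\<omega>\<^sub>2\<^sup>2\<close>; as \<open>\<theta> \<noteq> 0\<close>, these two coefficients agree.\<close>

lemma invariant_low_degree:
  assumes "sym_map s1 p = p" "sym_map s2 p = p" "const_term p = 0"
  shows "p \<in> low_degree_multiples"
proof -
  have s1: "s1 omega1 = (- 1, theta)" "s1 omega2 = (0, 1)"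
    and s2: "s2 omega1 = (1, 0)" "s2 omega2 = (theta, - 1)"
    by (simp_all add: omega1_def omega2_def s1_eq s2_eq)
  note A = coeff_sym_map_low[of s1 p, unfolded assms s1 fst_conv snd_conv]
  note B = coeff_sym_map_low[of s2 p, unfolded assms s2 fst_conv snd_conv]
  have dbl: "z = 0" if "2 * z = (0::zgolden)" for z using that by simp
  have "2 * coeff (coeff p 0) 1 = 0" using A(1) by (simp add: eq_neg_iff_add_eq_0)
  then have c10: "coeff (coeff p 0) 1 = 0" by (rule dbl)
  have "2 * coeff (coeff p 1) 0 = 0" using B(2) by (simp add: eq_neg_iff_add_eq_0)
  then have c01: "coeff (coeff p 1) 0 = 0" by (rule dbl)
  have "2 * (coeff (coeff p 1) 1 + theta * coeff (coeff p 0) 2) = 0"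
    using A(3) by (simp add: algebra_simps)
  then have a: "coeff (coeff p 1) 1 = - theta * coeff (coeff p 0) 2"
    by (metis dbl eq_neg_iff_add_eq_0 mult_minus_left)
  have "2 * (coeff (coeff p 1) 1 + theta * coeff (coeff p 2) 0) = 0"
    using B(3) by (simp add: algebra_simps)
  then have b: "coeff (coeff p 1) 1 = - theta * coeff (coeff p 2) 0"
    by (metis dbl eq_neg_iff_add_eq_0 mult_minus_left)
  have "theta \<noteq> 0" using theta_inverse by auto
  with a b have "coeff (coeff p 2) 0 = coeff (coeff p 0) 2" by simp
  with a c10 c01 assms(3) show ?thesis
    by (simp add: low_degree_multiples_def const_term_def)
qed

lemma sym_map_quad:
  "sym_map w (quad a b c) = const a * (sym_incl (w omega1) * sym_incl (w omega1))
     + const b * (sym_incl (w omega1) * sym_incl (w omega2))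
     + const c * (sym_incl (w omega2) * sym_incl (w omega2))"
proof -
  have "sym_map w (quad a b c) = sym_incl (w omega1) * (sym_incl (w omega1) * const a)
     + sym_incl (w omega2) * (sym_incl (w omega1) * const b + sym_incl (w omega2) * const c)"
    by (simp add: sym_map_def quad_def map_poly_pCons const_0)
  then show ?thesis by (simp only: distrib_left ac_simps)
qed

lemma invariant_form_invariant:
  assumes "w \<in> W"
  shows "sym_map w invariant_form = invariant_form"
  using assms unfolding W_eq dihedral_words_def invariant_form_def sym_map_quad
  by (auto simp: sym_incl_mult const_mult_quad quad_add quad_eq_iff
      omega1_def omega2_def s1_eq s2_eq algebra_simps theta_sq theta_sq')

lemma invariant_ideal2_eq: "invariant_ideal2 = range (\<lambda>r. const r * invariant_form)"
proof (intro equalityI subsetI)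
  fix p assume "p \<in> invariant_ideal2"
  then have p: "p \<in> invariant_ideal" "p \<in> sym_deg2" by (auto simp: invariant_ideal2_def)
  have "invariant_ideal \<subseteq> low_degree_multiples"
    unfolding invariant_ideal_def
    by (rule sym_self.span_minimal[OF _ low_degree_multiples_subspace])
      (auto intro: invariant_low_degree simp: W_s1 W_s2)
  with p(1) have "p \<in> low_degree_multiples" by blast
  then have "p = const (coeff (coeff p 0) 2) * invariant_form"
    unfolding multiple_of_invariant_form
    using sym_deg2_eq_quad[OF p(2)] by (simp add: low_degree_multiples_def)
  then show "p \<in> range (\<lambda>r. const r * invariant_form)" by blast
next
  fix p assume "p \<in> range (\<lambda>r. const r * invariant_form)"
  then obtain r where p: "p = const r * invariant_form" by blast
  have "invariant_form \<in> {p. (\<forall>w\<in>W. sym_map w p = p) \<and> const_term p = 0}"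
    by (simp add: invariant_form_invariant) (simp add: const_term_def invariant_form_def quad_def)
  then have "p \<in> invariant_ideal"
    unfolding p invariant_ideal_def by (intro sym_self.span_scale sym_self.span_base)
  moreover have "p \<in> sym_deg2"
    unfolding p multiple_of_invariant_form
    by (auto simp: quad_def sym_deg2_def coeff_pCons split: nat.splits if_splits)
  ultimately show "p \<in> invariant_ideal2" by (simp add: invariant_ideal2_def)
qed

section \<open>Sums over orbits\<close>

definition rot :: "lattice \<Rightarrow> lattice" where
  "rot v = s1 (s2 v)"

definition rot_orbit :: "lattice \<Rightarrow> lattice set" where
  "rot_orbit v = {v, rot v, rot (rot v), rot (rot (rot v)), rot (rot (rot (rot v)))}"

lemma rot_eq: "rot (a, b) = (- a - theta * b, theta * a + theta * b)"
  by (simp add: rot_def s1_eq s2_eq algebra_simps theta_sq theta_sq')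

lemma rot_5: "rot (rot (rot (rot (rot v)))) = v"
  by (cases v) (simp add: rot_eq algebra_simps theta_sq theta_sq')

text \<open>The rotations have index two in \<open>W\<close>, and \<open>s1\<close> represents the other coset.\<close>

lemma orbit_eq_rot_orbits: "orbit \<chi> = rot_orbit \<chi> \<union> rot_orbit (s1 \<chi>)"
  unfolding orbit_def W_eq dihedral_words_def rot_orbit_def
  by (cases \<chi>) (simp add: rot_eq s1_eq s2_eq algebra_simps theta_sq theta_sq' insert_commute)

lemma rot_orbit_eq: "w \<in> rot_orbit v \<Longrightarrow> rot_orbit w = rot_orbit v"
  by (auto simp: rot_orbit_def rot_5)

lemma rot_fixed: "rot v = v \<Longrightarrow> v = 0"
proof -
  assume fixed: "rot v = v"
  obtain a b where v: "v = (a, b)" by (cases v)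
  have e: "- a - theta * b = a" "theta * a + theta * b = b"
    using fixed by (simp_all add: v rot_eq)
  \<comment> \<open>Eliminating \<open>a\<close> leaves the determinant of \<open>rot - id\<close>, which is
    \<open>3 - theta\<close>, as the coefficient of \<open>b\<close>, up to sign.\<close>
  have "(theta - 3) * b = 2 * (theta * a + theta * b - b) + theta * (- a - theta * b - a)"
    by (simp add: algebra_simps theta_sq theta_sq')
  then have "(theta - 3) * b = 0" by (simp only: e) simp
  moreover have "real_of_zgolden (theta - 3) \<noteq> 0"
    using golden_bounds by (simp add: theta.rep_eq)
  then have "theta - 3 \<noteq> 0" by (metis real_of_zgolden_hom(1))
  ultimately have "b = 0" by simp
  with e have "2 * a = 0" by (simp add: eq_neg_iff_add_eq_0)
  then show "v = 0" using \<open>b = 0\<close> by (simp add: v zero_prod_def)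
qed

lemma sum_rot_orbit:
  assumes "v \<noteq> 0"
  shows "sum f (rot_orbit v) = f v + f (rot v) + f (rot (rot v)) + f (rot (rot (rot v)))
    + f (rot (rot (rot (rot v))))"
proof -
  have inj: "x = y" if "rot x = rot y" for x y using that rot_5 by metis
  have "rot v \<noteq> v" using rot_fixed assms by blast
  moreover have "rot (rot v) \<noteq> v" using calculation rot_5 by metis
  moreover have "rot (rot (rot v)) \<noteq> v" using calculation rot_5 by metis
  moreover have "rot (rot (rot (rot v))) \<noteq> v" using calculation rot_5 by metis
  ultimately have "distinct [v, rot v, rot (rot v), rot (rot (rot v)), rot (rot (rot (rot v)))]"
    by (auto dest!: inj)
  then show ?thesis by (simp add: rot_orbit_def add.assoc)
qed

text \<open>This is where \<open>\<surd>5\<close> enters. For \<open>\<chi> = a\<omega>\<^sub>1 + b\<omega>\<^sub>2\<close> the multiplier is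
  \<open>\<theta> (a\<^sup>2 + \<theta>ab + b\<^sup>2)\<close>: the sum is invariant under the rotations both as a polynomial and as a
  function of \<open>\<chi>\<close>, and \<open>a\<^sup>2 + \<theta>ab + b\<^sup>2\<close> is the invariant form of the coordinates.\<close>

lemma sum_sym_incl_sq_rot_orbit:
  "\<exists>r. (\<Sum>v\<in>rot_orbit \<chi>. sym_incl v ^ 2) = 2 * (const ((2 * theta - 1) * r) * invariant_form)"
proof (cases "\<chi> = 0")
  case True
  have "rot (0, 0) = (0, 0)" by (simp add: rot_eq)
  then have "(\<Sum>v\<in>rot_orbit \<chi>. sym_incl v ^ 2) = 0"
    by (simp add: True zero_prod_def rot_orbit_def sym_incl_poly)
  then show ?thesis by (intro exI[of _ 0]) (simp add: const_0)
next
  case False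
  obtain a b where ab: "\<chi> = (a, b)" by (cases \<chi>)
  show ?thesis
    unfolding sum_rot_orbit[OF False] multiple_of_invariant_form
    by (intro exI[of _ "theta * (a * a + theta * a * b + b * b)"])
      (simp add: ab rot_eq power2_eq_square sym_incl_mult quad_add double_quad quad_eq_iff
        algebra_simps theta_sq theta_sq')
qed

lemma phi1_eq_0: "phi1 \<chi> = 0"
  unfolding phi1_def sym_incl_def
  by (simp add: sum.distrib sum_distrib_right[symmetric] const_sum const_0 orbit_sum)

lemma phi2_double_eq: "phi2_double \<chi> = (\<Sum>v\<in>orbit \<chi>. sym_incl v ^ 2)"
  unfolding phi2_double_def lambda2_def
  by (simp add: sum.distrib sum_distrib_right[symmetric] const_sum const_0 orbit_sum)

lemma phi2_eqI: "2 * q = phi2_double \<chi> \<Longrightarrow> phi2 \<chi> = q"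
  unfolding phi2_def using phi2_ex1[of \<chi>] by (rule the1_equality)

text \<open>Two rotation orbits are equal or disjoint, so that the orbit sum is one rotation-orbit sum or
  the sum of two of them, whatever the stabiliser of \<open>\<chi>\<close> is.\<close>

lemma phi2_multiple: "\<exists>r. phi2 \<chi> = const ((2 * theta - 1) * r) * invariant_form"
proof -
  obtain r where r: "(\<Sum>v\<in>rot_orbit \<chi>. sym_incl v ^ 2)
      = 2 * (const ((2 * theta - 1) * r) * invariant_form)"
    using sum_sym_incl_sq_rot_orbit by blast
  obtain r' where r': "(\<Sum>v\<in>rot_orbit (s1 \<chi>). sym_incl v ^ 2)
      = 2 * (const ((2 * theta - 1) * r') * invariant_form)"
    using sum_sym_incl_sq_rot_orbit by blast
  have fin: "finite (rot_orbit v)" for v by (simp add: rot_orbit_def)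
  show ?thesis
  proof (cases "rot_orbit \<chi> \<inter> rot_orbit (s1 \<chi>) = {}")
    case True
    have "phi2_double \<chi> = 2 * (const ((2 * theta - 1) * (r + r')) * invariant_form)"
      unfolding phi2_double_eq orbit_eq_rot_orbits sum.union_disjoint[OF fin fin True] r r'
      by (simp only: distrib_left const_hom(1) distrib_right)
    then show ?thesis using phi2_eqI by metis
  next
    case False
    then have "rot_orbit (s1 \<chi>) = rot_orbit \<chi>" using rot_orbit_eq by blast
    then have "phi2_double \<chi> = 2 * (const ((2 * theta - 1) * r) * invariant_form)"
      by (simp add: phi2_double_eq orbit_eq_rot_orbits r)
    then show ?thesis using phi2_eqI by metis
  qed
qed

text \<open>The vector \<open>\<omega>\<^sub>1\<close> is fixed by \<open>s2\<close>, so its orbit is a single rotation orbit. A generic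
  orbit consists of two rotation orbits with equal sums, and its \<open>phi2\<close> is divisible by two.\<close>

lemma phi2_omega1: "phi2 omega1 = const ((2 * theta - 1) * theta) * invariant_form"
proof (rule phi2_eqI)
  have "s1 omega1 = rot omega1"
    by (simp add: omega1_def s1_eq rot_eq)
  then have "s1 omega1 \<in> rot_orbit omega1" by (simp add: rot_orbit_def)
  then have orbit: "orbit omega1 = rot_orbit omega1"
    by (simp add: orbit_eq_rot_orbits rot_orbit_eq)
  have "omega1 \<noteq> 0" by (simp add: omega1_def zero_prod_def)
  then show "2 * (const ((2 * theta - 1) * theta) * invariant_form) = phi2_double omega1"
    unfolding phi2_double_eq orbit multiple_of_invariant_form sum_rot_orbit[OF \<open>omega1 \<noteq> 0\<close>]
    by (simp add: omega1_def rot_eq power2_eq_square sym_incl_mult quad_add double_quad quad_eq_iff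
        algebra_simps theta_sq theta_sq')
qed

lemma P2_eq: "P2 = range (\<lambda>r. const ((2 * theta - 1) * r) * invariant_form)"
  (is "P2 = ?S")
proof
  have zero: "0 \<in> ?S"
    by (rule range_eqI[of _ _ 0]) (simp add: const_0)
  have "sym_R.subspace ?S"
    unfolding sym_R.subspace_def
  proof (intro conjI ballI allI)
    show "0 \<in> ?S" by (rule zero)
  next
    fix x y
    assume "x \<in> ?S" "y \<in> ?S"
    then obtain r r' where "x = const ((2 * theta - 1) * r) * invariant_form"
      "y = const ((2 * theta - 1) * r') * invariant_form" by blast
    then have "x + y = const ((2 * theta - 1) * (r + r')) * invariant_form"
      by (simp only: distrib_left const_hom(1) distrib_right)
    then show "x + y \<in> ?S" by blast
  next
    fix c x
    assume "x \<in> ?S"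
    then obtain r where "x = const ((2 * theta - 1) * r) * invariant_form" by blast
    then have "const c * x = const ((2 * theta - 1) * (c * r)) * invariant_form"
      by (simp only: const_hom(2) ac_simps)
    then show "const c * x \<in> ?S" by blast
  qed
  moreover have "range phi2 \<union> {sym_incl f * phi1 \<chi> | f \<chi>. True} \<subseteq> ?S"
  proof -
    have "sym_incl f * phi1 \<chi> \<in> ?S" for f \<chi>
      using zero by (simp only: phi1_eq_0 mult_zero_right)
    moreover have "phi2 \<chi> \<in> ?S" for \<chi>
      using phi2_multiple[of \<chi>] by blast
    ultimately show ?thesis by blast
  qed
  ultimately show "P2 \<subseteq> ?S"
    unfolding P2_def by (intro sym_R.span_minimal)
next
  have "const ((2 * theta - 1) * r) * invariant_form \<in> P2" for r
  proof -
    \<comment> \<open>\<open>theta - 1\<close> is the inverse of the unit \<open>theta\<close> that occurs in \<open>phi2 omega1\<close>.\<close>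
    have "(2 * theta - 1) * r = r * (theta - 1) * ((2 * theta - 1) * theta)"
      using theta_inverse by (metis mult.assoc mult.commute mult_1)
    then have "const ((2 * theta - 1) * r) * invariant_form = const (r * (theta - 1)) * phi2 omega1"
      by (simp only: phi2_omega1 const_hom(2) mult.assoc)
    then show ?thesis unfolding P2_def
      by (simp only:) (intro sym_R.span_scale sym_R.span_base, blast)
  qed
  then show "?S \<subseteq> P2" by blast
qed

lemma multiplier_iff:
  "(\<forall>p\<in>invariant_ideal2. const N * p \<in> P2) \<longleftrightarrow> (2 * theta - 1) dvd N"
proof
  assume "\<forall>p\<in>invariant_ideal2. const N * p \<in> P2"
  then have "const N * (const 1 * invariant_form) \<in> P2" unfolding invariant_ideal2_eq by blast
  then obtain r where "const N * invariant_form = const ((2 * theta - 1) * r) * invariant_form"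
    unfolding P2_eq const_hom(3) mult_1_left by blast
  then have "N = (2 * theta - 1) * r"
    unfolding multiple_of_invariant_form quad_eq_iff by (rule conjunct1)
  then show "(2 * theta - 1) dvd N" by simp
next
  assume "(2 * theta - 1) dvd N"
  then obtain k where "N = (2 * theta - 1) * k" by (rule dvdE)
  then have "const N * (const r * invariant_form) = const ((2 * theta - 1) * (k * r)) * invariant_form"
    for r by (simp only: const_hom(2) mult.assoc)
  then show "\<forall>p\<in>invariant_ideal2. const N * p \<in> P2"
    unfolding invariant_ideal2_eq P2_eq by blast
qed

section \<open>The second exponent\<close>

text \<open>Since \<open>s\<close> is itself a non-zero multiple of \<open>s\<close>, a greatest common divisor divides \<open>s\<close>
  as well as being divisible by it.\<close>

lemma is_gcd_of_nonzero_multiples: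
  fixes s t :: "'a :: idom"
  assumes "s \<noteq> 0"
  shows "is_gcd_of t {N. N \<noteq> 0 \<and> s dvd N} \<longleftrightarrow> (\<exists>u. u dvd 1 \<and> t = u * s)"
proof
  assume "is_gcd_of t {N. N \<noteq> 0 \<and> s dvd N}"
  then have "t dvd s" "s dvd t" using assms by (auto simp: is_gcd_of_def)
  then obtain u k where u: "t = s * u" and k: "s = t * k" by (metis dvd_def)
  have "s * (u * k) = s * 1" using k unfolding u by (simp only: mult.assoc mult_1_right)
  then have "u * k = 1" using assms by simp
  then show "\<exists>u. u dvd 1 \<and> t = u * s" using u by (metis dvd_def mult.commute)
next
  assume "\<exists>u. u dvd 1 \<and> t = u * s"
  then obtain u where u: "u dvd 1" "t = u * s" by blast
  have "t dvd s" unfolding u(2) using mult_dvd_mono[OF u(1) dvd_refl[of s]] by simp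
  moreover have "s dvd t" unfolding u(2) by (rule dvd_triv_right)
  ultimately show "is_gcd_of t {N. N \<noteq> 0 \<and> s dvd N}"
    unfolding is_gcd_of_def using assms by (blast intro: dvd_trans)
qed

theorem theorem7p1:
  fixes \<tau> :: zgolden
  shows "is_second_exponent \<tau> \<longleftrightarrow>
           (\<exists>u :: zgolden. u dvd 1 \<and> real_of_zgolden \<tau> = real_of_zgolden u * sqrt 5)"
proof -
  have "real_of_zgolden (2 * theta - 1) \<noteq> 0" by (simp only: real_of_zgolden_sqrt5) simp
  then have "2 * theta - 1 \<noteq> 0" by (metis real_of_zgolden_hom(1))
  then have "is_second_exponent \<tau> \<longleftrightarrow> (\<exists>u. u dvd 1 \<and> \<tau> = u * (2 * theta - 1))"
    unfolding is_second_exponent_def multiplier_iff by (rule is_gcd_of_nonzero_multiples)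
  also have "\<dots> \<longleftrightarrow> (\<exists>u. u dvd 1 \<and> real_of_zgolden \<tau> = real_of_zgolden (u * (2 * theta - 1)))"
    by (simp only: real_of_zgolden_inject)
  also have "\<dots> \<longleftrightarrow> (\<exists>u. u dvd 1 \<and> real_of_zgolden \<tau> = real_of_zgolden u * sqrt 5)"
    by (simp only: real_of_zgolden_hom(6) real_of_zgolden_sqrt5)
  finally show ?thesis .
qed

end
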